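(* Let $\gamma>0$ and let $X_1,\dots,X_n$ be independent and identically distributed from $F$ (density $f$), an absolutely continuous $\gamma$-unimodal distribution on $\mathbb{R}^d$ with a unique mode $\theta_0\in\mathbb{R}^d$. Let $\mathcal{A}(\cdot,\cdot)$ be an algorithm which, given univariate data $\{y_i\}_{i=1}^n$ and a level $1-\alpha$, returns a finite sample valid $(1-\alpha)$ confidence set $\mathcal{A}(\{y_i\}_{i=1}^n,1-\alpha)\subset\mathbb{R}$ for the mode of a unimodal univariate distribution. For $\theta\in\mathbb{R}^d$ let $$\widehat{\mathrm{CS}}_{n,\alpha}^{\theta;\gamma}=\mathcal{A}\big(\{\|X_i-\theta\|_2^\gamma\}_{i=1}^n,1-\alpha\big),$$ and define $$\widehat{\mathrm{CS}}_{n,\alpha}^{\gamma}=\big\{\theta\in\mathbb{R}^d\;:\;0\in\widehat{\mathrm{CS}}_{n,\alpha}^{\theta;\gamma}\big\}.$$ Then for all $n\ge1$ and all $\alpha\in(0,1)$, $$\mathbb{P}_F\big(\theta_0\in\widehat{\mathrm{CS}}_{n,\alpha}^{\gamma}\big)\ge1-\alpha.$$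
   Context: A random vector $X\in\mathbb{R}^d$ has a $\gamma$-unimodal distribution about $0$ ($\gamma>0$) if for every bounded, nonnegative, Borel measurable $g:\mathbb{R}^d\to\mathbb{R}$ the quantity $t^\gamma\,\mathbb{E}[g(tX)]$ is non-decreasing in $t\in(0,\infty)$; $X$ is $\gamma$-unimodal about (with mode) $\theta_0$ if $X-\theta_0$ is $\gamma$-unimodal about $0$. A univariate distribution function $G$ is unimodal about (with mode) $\eta$ if $G$ is convex on $(-\infty,\eta]$ and concave on $[\eta,\infty)$. Finite sample validity of $\mathcal{A}$ at level $1-\alpha$ means: whenever $Y_1,\dots,Y_n$ are i.i.d. from a univariate distribution unimodal about $\eta$, $\mathbb{P}(\eta\in\mathcal{A}(\{Y_i\}_{i=1}^n,1-\alpha))\ge1-\alpha$, for all $n\ge 1$, $\alpha\in(0,1)$. *)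

theory Defs
  imports "HOL-Probability.Probability"
begin

text \<open>Distributions are measures on the Borel sigma-algebra: the random vector of law \<open>F\<close>
  enters only through expectations under \<open>F\<close>.\<close>

definition gamma_unimodal_about_0 :: "real \<Rightarrow> (real ^ 'd) measure \<Rightarrow> bool" where
  "gamma_unimodal_about_0 \<gamma> F \<longleftrightarrow>
     (\<forall>g :: real ^ 'd \<Rightarrow> real.
        g \<in> borel_measurable borel \<and> bounded (range g) \<and> (\<forall>x. 0 \<le> g x) \<longrightarrow>
        mono_on {0<..} (\<lambda>t. t powr \<gamma> * (\<integral>x. g (t *\<^sub>R x) \<partial>F)))"

definition gamma_unimodal_about :: "real \<Rightarrow> (real ^ 'd) measure \<Rightarrow> real ^ 'd \<Rightarrow> bool" where
  "gamma_unimodal_about \<gamma> F \<theta> \<longleftrightarrow> gamma_unimodal_about_0 \<gamma> (distr F borel (\<lambda>x. x - \<theta>))"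

definition unimodal_cdf_about :: "(real \<Rightarrow> real) \<Rightarrow> real \<Rightarrow> bool" where
  "unimodal_cdf_about G \<eta> \<longleftrightarrow> convex_on {..\<eta>} G \<and> concave_on {\<eta>..} G"

definition iid_sample ::
    "'w measure \<Rightarrow> nat \<Rightarrow> (nat \<Rightarrow> 'w \<Rightarrow> 'a :: topological_space) \<Rightarrow> 'a measure \<Rightarrow> bool" where
  "iid_sample P n X F \<longleftrightarrow>
     prob_space P \<and>
     prob_space.indep_vars P (\<lambda>_. borel) X {..<n} \<and>
     (\<forall>i<n. distr P borel (X i) = F)"

text \<open>The sample space has carrier type \<^typ>\<open>nat \<Rightarrow> real\<close> because a definition cannot quantify
  over types. Nothing is lost: the canonical space \<open>PiM {..<n} (\<lambda>_. Q)\<close> with the coordinate maps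
  is included, and validity there carries over to i.i.d. samples on any probability space.
  No separate measurability condition is needed: non-measurable sets have \<^const>\<open>measure\<close> 0,
  so the bound by \<open>1 - \<alpha> > 0\<close> entails that the coverage event is measurable.\<close>

definition finite_sample_valid :: "(real list \<Rightarrow> real \<Rightarrow> real set) \<Rightarrow> bool" where
  "finite_sample_valid A \<longleftrightarrow>
     (\<forall>n \<alpha> \<eta> Q (P :: (nat \<Rightarrow> real) measure) Y.
        1 \<le> n \<and> 0 < \<alpha> \<and> \<alpha> < 1 \<and>
        real_distribution Q \<and> unimodal_cdf_about (cdf Q) \<eta> \<and> iid_sample P n Y Q \<longrightarrow>
        1 - \<alpha> \<le> measure P {\<omega> \<in> space P. \<eta> \<in> A (map (\<lambda>i. Y i \<omega>) [0..<n]) (1 - \<alpha>)})"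

definition mode_conf_set_at ::
    "(real list \<Rightarrow> real \<Rightarrow> real set) \<Rightarrow> real \<Rightarrow> real \<Rightarrow> (real ^ 'd) list \<Rightarrow> real ^ 'd \<Rightarrow> real set" where
  "mode_conf_set_at A \<gamma> \<alpha> xs \<theta> = A (map (\<lambda>x. norm (x - \<theta>) powr \<gamma>) xs) (1 - \<alpha>)"

definition mode_conf_set ::
    "(real list \<Rightarrow> real \<Rightarrow> real set) \<Rightarrow> real \<Rightarrow> real \<Rightarrow> (real ^ 'd) list \<Rightarrow> (real ^ 'd) set" where
  "mode_conf_set A \<gamma> \<alpha> xs = {\<theta>. 0 \<in> mode_conf_set_at A \<gamma> \<alpha> xs \<theta>}"

end

theory Submission
  imports Defs
begin

text \<open>Let \<open>Q\<close> be the law of \<open>\<parallel>X - \<theta>\<^sub>0\<parallel>\<close> raised to the power \<open>\<gamma>\<close>, and \<open>G\<close> its distribution function.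
  Testing \<open>\<gamma>\<close>-unimodality on indicators of the shells \<open>a < \<parallel>x\<parallel> powr \<gamma> \<le> b\<close> gives
  \<open>G (l * b) - G (l * a) \<le> l * (G b - G a)\<close> for \<open>l \<ge> 1\<close>. Hence the chord slopes of \<open>G\<close> decrease
  along every geometric grid, and right-continuity of \<open>G\<close> extends this to concavity on \<open>[0, \<infinity>)\<close>.
  As \<open>F\<close> has no atom at \<open>\<theta>\<^sub>0\<close>, \<open>G\<close> vanishes on \<open>(-\<infinity>, 0]\<close>, so \<open>Q\<close> is unimodal about \<open>0\<close> and the
  validity of \<open>A\<close> applies to the transformed sample.\<close>

section \<open>Concavity from an inequality for scaled increments\<close>

text \<open>From one grid cell to the next, the increment of \<open>G\<close> grows by at most the
  factor \<open>l\<close> and the cell width by exactly \<open>l\<close>, so chord slopes decrease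
  along the grid \<open>p * l ^ i\<close>. The cross-multiplied conclusion stays meaningful when
  \<open>m = 0\<close> or \<open>m = k\<close>.\<close>

lemma geometric_chord_slopes:
  fixes G :: "real \<Rightarrow> real"
  assumes sc: "\<And>a b. 0 \<le> a \<Longrightarrow> a \<le> b \<Longrightarrow> G (l * b) - G (l * a) \<le> l * (G b - G a)"
    and l: "1 < l" and p: "0 < p" and mk: "m \<le> k"
  shows "(G (p * l ^ k) - G (p * l ^ m)) * (p * l ^ m - p) \<le> (G (p * l ^ m) - G p) * (p * l ^ k - p * l ^ m)"
proof -
  define q where "q i = p * l ^ i" for i
  define s where "s i = (G (q (Suc i)) - G (q i)) / (q (Suc i) - q i)" for i
  have qpos: "0 < q i" for i using l p by (simp add: q_def)
  have qSuc: "q (Suc i) = l * q i" for i by (simp add: q_def)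
  have qlt: "q i < q (Suc i)" for i using qpos[of i] l by (simp add: qSuc)
  have s_eq: "G (q (Suc i)) - G (q i) = s i * (q (Suc i) - q i)" for i
    using qlt[of i] by (simp add: s_def)
  have "s (Suc i) \<le> s i" for i
  proof -
    have "G (q (Suc (Suc i))) - G (q (Suc i)) \<le> l * (G (q (Suc i)) - G (q i))"
      using sc[of "q i" "q (Suc i)"] qpos[of i] qlt[of i] by (simp add: qSuc)
    then have "s (Suc i) \<le> l * (G (q (Suc i)) - G (q i)) / (q (Suc (Suc i)) - q (Suc i))"
      unfolding s_def using qlt[of "Suc i"] by (intro divide_right_mono) auto
    also have "q (Suc (Suc i)) - q (Suc i) = l * (q (Suc i) - q i)"
      by (simp add: qSuc algebra_simps)
    also have "l * (G (q (Suc i)) - G (q i)) / (l * (q (Suc i) - q i)) = s i"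
      using l by (simp add: s_def)
    finally show ?thesis .
  qed
  then have s_anti: "s j \<le> s i" if "i \<le> j" for i j using that by (rule lift_Suc_antimono_le)
  \<comment> \<open>Slopes from index \<open>m\<close> on are at most \<open>s m\<close> and earlier
    ones at least \<open>s m\<close>. Telescoping makes \<open>s m\<close> a separator between the
    slopes of the two long chords.\<close>
  have up: "G (q k) - G (q m) \<le> s m * (q k - q m)"
    using mk
  proof (induction k rule: dec_induct)
    case (step j)
    have "G (q (Suc j)) - G (q j) \<le> s m * (q (Suc j) - q j)"
      unfolding s_eq using s_anti[of m j] step.hyps qlt[of j] by (intro mult_right_mono) auto
    then show ?case using step.IH by (simp add: algebra_simps)
  qed simp
  have low: "s m * (q j - q 0) \<le> G (q j) - G (q 0)" if "j \<le> m" for j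
    using that
  proof (induction j)
    case (Suc j)
    have "s m * (q (Suc j) - q j) \<le> G (q (Suc j)) - G (q j)"
      unfolding s_eq using s_anti[of j m] Suc.prems qlt[of j] by (intro mult_right_mono) auto
    then show ?case using Suc by (simp add: algebra_simps)
  qed simp
  have qmono: "q i \<le> q j" if "i \<le> j" for i j
    using less_imp_le[OF qlt] that by (rule lift_Suc_mono_le)
  have "(G (q k) - G (q m)) * (q m - q 0) \<le> s m * (q k - q m) * (q m - q 0)"
    using up qmono[of 0 m] by (intro mult_right_mono) auto
  also have "\<dots> = s m * (q m - q 0) * (q k - q m)" by simp
  also have "\<dots> \<le> (G (q m) - G (q 0)) * (q k - q m)"
    using low[of m] qmono[OF mk] by (intro mult_right_mono) auto
  finally show ?thesis by (simp add: q_def)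
qed

text \<open>The three-point slope inequality holds exactly when all points lie on one geometric
  grid. For general \<open>0 < a < c < b\<close> the grid is fitted to \<open>a\<close> and
  \<open>c\<close> and refined, and \<open>b\<close> is reached as a limit from the right, where
  one-sided continuity suffices.\<close>

lemma concave_on_if_subhomogeneous_increments:
  fixes G :: "real \<Rightarrow> real"
  assumes sc: "\<And>l a b. 1 \<le> l \<Longrightarrow> 0 \<le> a \<Longrightarrow> a \<le> b \<Longrightarrow> G (l * b) - G (l * a) \<le> l * (G b - G a)"
    and rc: "\<And>x. 0 < x \<Longrightarrow> continuous (at_right x) G"
  shows "concave_on {0..} G"
proof -
  have three: "(G b - G c) * (c - a) \<le> (G c - G a) * (b - c)" if abc: "0 \<le> a" "a < c" "c < b" for a b c
  proof (cases "a = 0")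
    case True
    \<comment> \<open>No geometric grid starts at \<open>0\<close>, but here a single scaling of the
      interval from \<open>0\<close> to \<open>c\<close> by \<open>b / c\<close> suffices.\<close>
    have "G b - G 0 \<le> b / c * (G c - G 0)"
      using sc[of "b / c" 0 c] abc True by simp
    then have "(G b - G 0) * c \<le> b * (G c - G 0)"
      using abc True by (simp add: pos_le_divide_eq)
    then show ?thesis using True by (simp add: algebra_simps)
  next
    case False
    with abc have a: "0 < a" by simp
    define r where "r = c / a"
    have r: "1 < r" using a abc by (simp add: r_def)
    define L where "L = log r (b / a)"
    have rL: "a * r powr L = b" using r a abc by (simp add: L_def)
    have L1: "1 < L" using r a abc by (simp add: L_def less_log_iff r_def divide_strict_right_mono)
    \<comment> \<open>The grid \<open>a * (r powr (1 / Suc m)) ^ j\<close> contains \<open>c\<close>; its first point \<open>q m\<close> beyond \<open>b\<close>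
      tends to \<open>b\<close> from the right.\<close>
    define e where "e m = real (nat \<lfloor>real (Suc m) * L\<rfloor> + 1) / real (Suc m)" for m
    have e_eq: "e m = (of_int \<lfloor>real (Suc m) * L\<rfloor> + 1) / real (Suc m)" for m
      using L1 by (simp add: e_def)
    \<comment> \<open>Adding \<open>1\<close> to the floor keeps this strict even if
      \<open>real (Suc m) * L\<close> is an integer; convergence in \<open>at_right b\<close> needs
      \<open>q m\<close> to differ from \<open>b\<close>.\<close>
    have e_gt: "L < e m" for m
      unfolding e_eq by (subst pos_less_divide_eq) (auto simp: mult.commute)
    have e_le: "e m \<le> L + 1 / real (Suc m)" for m
    proof -
      have "e m \<le> (real (Suc m) * L + 1) / real (Suc m)"
        unfolding e_eq by (intro divide_right_mono) linarith+
      then show ?thesis by (simp add: add_divide_distrib)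
    qed
    have "(\<lambda>m. L + 1 / real (Suc m)) \<longlonglongrightarrow> L + 0"
      by (intro tendsto_intros LIMSEQ_Suc lim_1_over_n)
    then have e_lim: "e \<longlonglongrightarrow> L"
      using e_gt e_le by (intro tendsto_sandwich[of "\<lambda>_. L" e _ "\<lambda>m. L + 1 / real (Suc m)"])
        (simp_all add: less_imp_le)
    define q where "q m = a * r powr e m" for m
    have "q \<longlonglongrightarrow> a * r powr L" unfolding q_def using r e_lim by (intro tendsto_intros) auto
    then have q_lim: "q \<longlonglongrightarrow> b" by (simp add: rL)
    have q_gt: "b < q m" for m
      unfolding rL[symmetric] q_def using r a e_gt[of m] by simp
    have "filterlim q (at_right b) sequentially"
      using q_lim q_gt by (auto simp: filterlim_at less_imp_neq intro!: always_eventually)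
    moreover have "(G \<longlongrightarrow> G b) (at_right b)"
      using rc[of b] a abc by (simp add: continuous_within)
    ultimately have Gq: "(\<lambda>m. G (q m)) \<longlonglongrightarrow> G b" by (rule filterlim_compose[rotated])
    have "(G (q m) - G c) * (c - a) \<le> (G c - G a) * (q m - c)" for m
    proof -
      define l where "l = r powr (1 / real (Suc m))"
      have l: "1 < l" using r by (simp add: l_def)
      have pow: "l ^ j = r powr (real j / real (Suc m))" for j
        using r by (simp add: l_def powr_realpow[symmetric] powr_powr)
      have lc: "a * l ^ Suc m = c" using r a unfolding pow by (simp add: r_def)
      define k where "k = nat \<lfloor>real (Suc m) * L\<rfloor> + 1"
      have lq: "a * l ^ k = q m" unfolding pow by (simp add: q_def e_def k_def)
      \<comment> \<open>The point \<open>c\<close> has grid index \<open>Suc m\<close>;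
        \<open>L > 1\<close> places it no later than \<open>q m\<close>, which has index
        \<open>k\<close>.\<close>
      have "real (Suc m) * 1 \<le> real (Suc m) * L" using L1 by (intro mult_left_mono) auto
      then have "int (Suc m) \<le> \<lfloor>real (Suc m) * L\<rfloor>" by (simp only: le_floor_iff) simp
      then have "Suc m \<le> k" unfolding k_def by linarith
      from geometric_chord_slopes[of G l, OF sc l a this] l show ?thesis unfolding lc lq by simp
    qed
    then have le: "\<exists>N. \<forall>m\<ge>N. (G (q m) - G c) * (c - a) \<le> (G c - G a) * (q m - c)" by blast
    have "(\<lambda>m. (G (q m) - G c) * (c - a)) \<longlonglongrightarrow> (G b - G c) * (c - a)"
      by (intro tendsto_intros Gq)
    moreover have "(\<lambda>m. (G c - G a) * (q m - c)) \<longlonglongrightarrow> (G c - G a) * (b - c)"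
      by (intro tendsto_intros q_lim)
    ultimately show ?thesis using le by (rule LIMSEQ_le)
  qed
  show ?thesis
    unfolding concave_on_def
  proof (rule convex_on_linorderI)
    fix t x y :: real
    assume t: "0 < t" "t < 1" and xy: "x \<in> {0..}" "y \<in> {0..}" "x < y"
    define c where "c = (1 - t) * x + t * y"
    have cx: "c - x = t * (y - x)" and yc: "y - c = (1 - t) * (y - x)"
      by (simp_all add: c_def algebra_simps)
    have "0 < c - x" "0 < y - c" unfolding cx yc using t xy by auto
    then have "(G y - G c) * (c - x) \<le> (G c - G x) * (y - c)"
      using three[of x c y] xy by simp
    then have "((G y - G c) * t) * (y - x) \<le> ((G c - G x) * (1 - t)) * (y - x)"
      unfolding cx yc by (simp only: mult.assoc)
    then have "(G y - G c) * t \<le> (G c - G x) * (1 - t)"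
      using xy by (simp add: mult_le_cancel_right)
    then have "- G c \<le> (1 - t) * - G x + t * - G y" by (simp add: algebra_simps)
    then show "- G ((1 - t) *\<^sub>R x + t *\<^sub>R y) \<le> (1 - t) * - G x + t * - G y"
      by (simp add: c_def)
  qed simp
qed

text \<open>Scaling a vector by \<open>t\<close> multiplies the \<gamma>-th power of its norm by
  \<open>t powr \<gamma>\<close>. The test function is the indicator that this power lies in
  \<open>B\<close>, and the bound compares the scales \<open>1\<close> and
  \<open>t = l powr (1 / \<gamma>)\<close>.\<close>

lemma gamma_unimodal_norm_powr_scaling:
  fixes F :: "(real ^ 'd) measure" and \<theta> :: "real ^ 'd"
  assumes \<gamma>: "0 < \<gamma>" and F: "prob_space F" "sets F = sets borel"
    and uni: "gamma_unimodal_about \<gamma> F \<theta>"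
    and l: "1 \<le> l" and B: "B \<in> sets borel"
  defines "Q \<equiv> distr F borel (\<lambda>x. norm (x - \<theta>) powr \<gamma>)"
  shows "measure Q B \<le> l * measure Q {y. l * y \<in> B}"
proof -
  interpret F: prob_space F by (rule F)
  have [measurable_cong]: "sets F = sets borel" by (rule F)
  have spF: "space F = UNIV" using F(2) by (simp add: sets_eq_imp_space_eq)
  define g :: "real ^ 'd \<Rightarrow> real" where "g x = indicator B (norm x powr \<gamma>)" for x
  note [measurable] = B
  have gm [measurable]: "g \<in> borel_measurable borel" unfolding g_def by measurable
  have g_nonneg: "0 \<le> g x" for x by (simp add: g_def)
  define t where "t = l powr (1 / \<gamma>)"
  have t: "1 \<le> t" and tl: "t powr \<gamma> = l"
    using l \<gamma> by (auto simp: t_def powr_powr ge_one_powr_ge_zero)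
  have int: "(\<integral>x. g (s *\<^sub>R x) \<partial>distr F borel (\<lambda>x. x - \<theta>)) = measure Q {y. s powr \<gamma> * y \<in> B}"
    if "0 < s" for s
  proof -
    have "(\<integral>x. g (s *\<^sub>R x) \<partial>distr F borel (\<lambda>x. x - \<theta>)) = (\<integral>x. g (s *\<^sub>R (x - \<theta>)) \<partial>F)"
      by (rule integral_distr) measurable
    also have "\<dots> = (\<integral>x. indicator {x. s powr \<gamma> * norm (x - \<theta>) powr \<gamma> \<in> B} x \<partial>F)"
      using that by (intro Bochner_Integration.integral_cong) (auto simp: g_def powr_mult indicator_def)
    also have "\<dots> = measure F {x. s powr \<gamma> * norm (x - \<theta>) powr \<gamma> \<in> B}"
      by (simp add: spF)
    also have "\<dots> = measure Q {y. s powr \<gamma> * y \<in> B}"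
      unfolding Q_def by (subst measure_distr) (auto simp: spF intro!: arg_cong2[where f=measure])
    finally show ?thesis .
  qed
  have "mono_on {0<..} (\<lambda>t. t powr \<gamma> * (\<integral>x. g (t *\<^sub>R x) \<partial>distr F borel (\<lambda>x. x - \<theta>)))"
  proof -
    have "bounded (range g)" by (intro boundedI[of _ 1]) (auto simp: g_def indicator_def)
    with gm g_nonneg have "g \<in> borel_measurable borel \<and> bounded (range g) \<and> (\<forall>x. 0 \<le> g x)"
      by simp
    with uni[unfolded gamma_unimodal_about_def gamma_unimodal_about_0_def, rule_format] show ?thesis .
  qed
  from mono_onD[OF this, of 1 t] t show ?thesis
    by (simp add: int[of 1, simplified] int tl)
qed

lemma gamma_unimodal_norm_powr_unimodal:
  fixes F :: "(real ^ 'd) measure" and \<theta> :: "real ^ 'd"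
  assumes \<gamma>: "0 < \<gamma>" and F: "prob_space F" "sets F = sets borel"
    and uni: "gamma_unimodal_about \<gamma> F \<theta>"
    and no_atom: "measure F {\<theta>} = 0"
  defines "Q \<equiv> distr F borel (\<lambda>x. norm (x - \<theta>) powr \<gamma>)"
  shows "real_distribution Q" and "unimodal_cdf_about (cdf Q) 0"
proof -
  interpret F: prob_space F by (rule F)
  have [measurable_cong]: "sets F = sets borel" by (rule F)
  have spF: "space F = UNIV" using F(2) by (simp add: sets_eq_imp_space_eq)
  show rd: "real_distribution Q"
    unfolding Q_def by (intro F.real_distribution_distr) measurable
  interpret Q: real_distribution Q by (rule rd)
  have cdf_nonpos: "cdf Q y = 0" if "y \<le> 0" for y
  proof -
    have "cdf Q y \<le> cdf Q 0" using that by (rule Q.cdf_nondecreasing)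
    also have "cdf Q 0 = measure F {x. norm (x - \<theta>) powr \<gamma> \<le> 0}"
      unfolding cdf_def Q_def by (subst measure_distr) (auto simp: spF intro!: arg_cong2[where f=measure])
    also have "{x. norm (x - \<theta>) powr \<gamma> \<le> 0} = {\<theta>}"
      using powr_ge_zero[of _ \<gamma>] by (simp add: order_antisym_conv)
    finally show ?thesis using no_atom Q.cdf_nonneg[of y] by simp
  qed
  have "concave_on {0..} (cdf Q)"
  proof (rule concave_on_if_subhomogeneous_increments)
    fix l a b :: real
    assume l: "1 \<le> l" and ab: "0 \<le> a" "a \<le> b"
    show "cdf Q (l * b) - cdf Q (l * a) \<le> l * (cdf Q b - cdf Q a)"
    \<comment> \<open>Increments of the distribution function become measures of half-open intervals
      only for strictly ordered endpoints.\<close>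
    proof (cases "a = b")
      case False
      with ab have ab': "a < b" by simp
      with l have lab: "l * a < l * b" by simp
      have "measure Q {l * a<..l * b} \<le> l * measure Q {y. l * y \<in> {l * a<..l * b}}"
        unfolding Q_def by (rule gamma_unimodal_norm_powr_scaling[OF \<gamma> F uni l]) simp
      also have "{y. l * y \<in> {l * a<..l * b}} = {a<..b}" using l by auto
      finally show ?thesis by (simp add: Q.cdf_diff_eq ab' lab)
    qed simp
  qed (rule Q.cdf_is_right_cont)
  moreover have "convex_on {..0} (cdf Q)"
  proof (rule convex_onI)
    fix t x y :: real
    assume "0 < t" "t < 1" "x \<in> {..0}" "y \<in> {..0}"
    moreover from this have "(1 - t) *\<^sub>R x + t *\<^sub>R y \<in> {..0}"
      by (intro convexD_alt) auto
    ultimately show "cdf Q ((1 - t) *\<^sub>R x + t *\<^sub>R y) \<le> (1 - t) * cdf Q x + t * cdf Q y"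
      by (simp add: cdf_nonpos)
  qed simp
  ultimately show "unimodal_cdf_about (cdf Q) 0" by (simp add: unimodal_cdf_about_def)
qed

section \<open>Transfer of validity to arbitrary sample spaces\<close>

text \<open>Validity speaks only of sample spaces over \<open>nat \<Rightarrow> real\<close>. The
  joint law \<open>P\<close> of the sample lives there, its coordinates are again i.i.d. from
  \<open>Q\<close>, and the coverage event on \<open>M\<close> is the preimage under
  \<open>S\<close> of the one on \<open>P\<close>.\<close>

lemma finite_sample_valid_iid_sample:
  fixes Y :: "nat \<Rightarrow> 'w \<Rightarrow> real"
  assumes A: "finite_sample_valid A" and n: "1 \<le> n" and \<alpha>: "0 < \<alpha>" "\<alpha> < 1"
    and Q: "real_distribution Q" "unimodal_cdf_about (cdf Q) \<eta>"
    and iid: "iid_sample M n Y Q"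
  shows "1 - \<alpha> \<le> measure M {\<omega> \<in> space M. \<eta> \<in> A (map (\<lambda>i. Y i \<omega>) [0..<n]) (1 - \<alpha>)}"
proof -
  have M: "prob_space M" and ind: "prob_space.indep_vars M (\<lambda>_. borel) Y {..<n}"
    and law: "\<And>i. i < n \<Longrightarrow> distr M borel (Y i) = Q"
    using iid by (auto simp: iid_sample_def)
  interpret M: prob_space M by (rule M)
  interpret Q: real_distribution Q by (rule Q)
  have rv: "Y i \<in> borel_measurable M" if "i < n" for i
    using ind that by (auto simp: M.indep_vars_def)
  define S where "S \<omega> = (\<lambda>i\<in>{..<n}. Y i \<omega>)" for \<omega>
  define P where "P = distr M (PiM {..<n} (\<lambda>_. borel)) S"
  have S: "S \<in> measurable M (PiM {..<n} (\<lambda>_. borel))"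
    unfolding S_def using rv by (intro measurable_restrict) auto
  interpret P: prob_space P unfolding P_def by (rule M.prob_space_distr) (rule S)
  have S_comp: "S \<omega> i = Y i \<omega>" if "i < n" for i \<omega> using that by (simp add: S_def)
  have lawP: "distr P borel (\<lambda>x. x i) = Q" if i: "i < n" for i
  proof -
    have "distr P borel (\<lambda>x. x i) = distr M borel ((\<lambda>x. x i) \<circ> S)"
      unfolding P_def using i by (intro distr_distr S measurable_component_singleton) auto
    also have "(\<lambda>x. x i) \<circ> S = Y i" using i by (auto simp: S_comp)
    finally show ?thesis using law[OF i] by simp
  qed
  have P_eq: "P = PiM {..<n} (\<lambda>i. Q)"
  proof -
    have "P = PiM {..<n} (\<lambda>i. distr M borel (Y i))"
      using ind n rv unfolding P_def S_def
      by (subst M.indep_vars_iff_distr_eq_PiM'[symmetric]) (auto simp: lessThan_empty_iff)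
    also have "\<dots> = PiM {..<n} (\<lambda>i. Q)" by (intro PiM_cong) (auto simp: law)
    finally show ?thesis .
  qed
  have "P.indep_vars (\<lambda>_. borel) (\<lambda>i x. x i) {..<n}"
  proof (subst P.indep_vars_iff_distr_eq_PiM')
    show "{..<n} \<noteq> {}" using n by (auto simp: lessThan_empty_iff)
    show "(\<lambda>x. x i) \<in> borel_measurable P" if "i \<in> {..<n}" for i
      unfolding P_def using that by simp
    \<comment> \<open>Points of the product space are extensional, so restricting them to the index
      set changes nothing.\<close>
    have "distr P (PiM {..<n} (\<lambda>_. borel)) (\<lambda>x. \<lambda>i\<in>{..<n}. x i) = distr P (PiM {..<n} (\<lambda>_. borel)) (\<lambda>x. x)"
      by (intro distr_cong) (auto simp: P_def space_PiM PiE_restrict)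
    also have "\<dots> = P" by (intro distr_id2) (simp add: P_def)
    also have "\<dots> = PiM {..<n} (\<lambda>i. distr P borel (\<lambda>x. x i))"
      by (subst P_eq) (intro PiM_cong, auto simp: lawP)
    finally show "distr P (PiM {..<n} (\<lambda>_. borel)) (\<lambda>x. \<lambda>i\<in>{..<n}. x i) =
        PiM {..<n} (\<lambda>i. distr P borel (\<lambda>x. x i))" .
  qed
  then have "iid_sample P n (\<lambda>i x. x i) Q"
    by (auto simp: iid_sample_def lawP P.prob_space_axioms)
  define E where "E = {x \<in> space P. \<eta> \<in> A (map (\<lambda>i. x i) [0..<n]) (1 - \<alpha>)}"
  have cov: "1 - \<alpha> \<le> measure P E"
    using A n \<alpha> Q \<open>iid_sample P n (\<lambda>i x. x i) Q\<close> unfolding finite_sample_valid_def E_def by blast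
  \<comment> \<open>Nothing is known about measurability of \<open>A\<close>; it is the positive
    lower bound that rules out a non-measurable \<open>E\<close>, whose measure would be
    \<open>0\<close> by default.\<close>
  with \<alpha> have "E \<in> sets P" using measure_notin_sets[of E P] by fastforce
  then have "measure P E = measure M (S -` E \<inter> space M)"
    unfolding P_def using S by (intro measure_distr) auto
  also have "S -` E \<inter> space M = {\<omega> \<in> space M. \<eta> \<in> A (map (\<lambda>i. Y i \<omega>) [0..<n]) (1 - \<alpha>)}"
  proof -
    have "map (S \<omega>) [0..<n] = map (\<lambda>i. Y i \<omega>) [0..<n]" for \<omega>
      by (simp add: S_comp)
    then show ?thesis using measurable_space[OF S] by (auto simp: E_def P_def simp del: map_eq_conv)
  qed
  finally show ?thesis using cov by simp
qed

section \<open>Coverage of the mode\<close>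

theorem theorem9:
  fixes \<gamma> \<alpha> :: real and n :: nat
    and F :: "(real ^ 'd) measure" and f :: "real ^ 'd \<Rightarrow> real" and \<theta>\<^sub>0 :: "real ^ 'd"
    and M :: "'w measure" and X :: "nat \<Rightarrow> 'w \<Rightarrow> real ^ 'd"
    and A :: "real list \<Rightarrow> real \<Rightarrow> real set"
  assumes "\<gamma> > 0"
    and "f \<in> borel_measurable borel" and "\<And>x. 0 \<le> f x"
    and "F = density lborel (\<lambda>x. ennreal (f x))"
    and "gamma_unimodal_about \<gamma> F \<theta>\<^sub>0"
    and "\<And>\<theta>. gamma_unimodal_about \<gamma> F \<theta> \<Longrightarrow> \<theta> = \<theta>\<^sub>0"
    and "finite_sample_valid A"
    and "n \<ge> 1" and "0 < \<alpha>" and "\<alpha> < 1"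
    and "iid_sample M n X F"
  shows "measure M {\<omega> \<in> space M. \<theta>\<^sub>0 \<in> mode_conf_set A \<gamma> \<alpha> (map (\<lambda>i. X i \<omega>) [0..<n])} \<ge> 1 - \<alpha>"
proof -
  have M: "prob_space M" and ind: "prob_space.indep_vars M (\<lambda>_. borel) X {..<n}"
    and law: "\<And>i. i < n \<Longrightarrow> distr M borel (X i) = F"
    using assms(11) by (auto simp: iid_sample_def)
  interpret M: prob_space M by (rule M)
  have rv: "X i \<in> borel_measurable M" if "i < n" for i
    using ind that by (auto simp: M.indep_vars_def)
  \<comment> \<open>Total mass one comes from \<open>F\<close> being the law of \<open>X 0\<close>,
    which belongs to the sample because \<open>n \<ge> 1\<close>.\<close>
  have F: "prob_space F"
    using M.prob_space_distr[OF rv[of 0]] law[of 0] assms(8) by simp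
  have sF: "sets F = sets borel" by (simp add: assms(4))
  have "{\<theta>\<^sub>0} \<in> null_sets F"
  proof -
    have "AE x in lborel. x \<in> {\<theta>\<^sub>0} \<longrightarrow> ennreal (f x) = 0"
      using AE_lborel_singleton[of \<theta>\<^sub>0] by eventually_elim simp
    then show ?thesis
      unfolding assms(4) using assms(2) by (subst null_sets_density_iff) auto
  qed
  then have "measure F {\<theta>\<^sub>0} = 0" by (simp add: measure_def null_setsD1)
  then have Q: "real_distribution (distr F borel (\<lambda>x. norm (x - \<theta>\<^sub>0) powr \<gamma>))"
      "unimodal_cdf_about (cdf (distr F borel (\<lambda>x. norm (x - \<theta>\<^sub>0) powr \<gamma>))) 0"
    by (rule gamma_unimodal_norm_powr_unimodal[OF assms(1) F sF assms(5)])+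
  let ?h = "\<lambda>x :: real ^ 'd. norm (x - \<theta>\<^sub>0) powr \<gamma>"
  have h: "?h \<in> borel_measurable borel" by measurable
  have "M.indep_vars (\<lambda>_. borel) (\<lambda>i \<omega>. ?h (X i \<omega>)) {..<n}"
    using ind h by (rule M.indep_vars_compose2)
  moreover have "distr M borel (\<lambda>\<omega>. ?h (X i \<omega>)) = distr F borel ?h" if "i < n" for i
    using distr_distr[OF h rv[OF that]] by (simp add: law[OF that] comp_def)
  ultimately have "iid_sample M n (\<lambda>i \<omega>. ?h (X i \<omega>)) (distr F borel ?h)"
    by (simp add: iid_sample_def M)
  \<comment> \<open>Validity is used with \<eta> = 0: \<open>\<theta>\<^sub>0\<close> lies in the
    confidence set precisely when \<open>0\<close> lies in the set that \<open>A\<close> returns for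
    the transformed sample.\<close>
  from finite_sample_valid_iid_sample[OF assms(7-10) Q this] show ?thesis
    by (simp add: mode_conf_set_def mode_conf_set_at_def comp_def)
qed

end
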